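(* Let $a$, $b$ be non-zero integers and let $\ell=2^{\beta}d$ be a positive integer, where $d$ is an odd positive integer and $\beta\ge 0$, such that $a$, $b$, $\ell$ are pairwise coprime. 1. If $ab$ is odd, then $\ell=2^{\beta}d\in G_{(a,b)}$ if and only if one of the following statements holds: (a) $\beta\in\{0,1\}$ and $d=1$; (b) $\beta\in\{0,1\}$, $d\ge 3$, and there exists an integer $s\ge 1$ such that $2^s\,\|\,\mathrm{Ord}_p(ab^{-1})$ for every prime $p$ dividing $d$; (c) $\beta\ge 2$, $d=1$ and $ab^{-1}\equiv -1\pmod{2^{\beta}}$; (d) $\beta\ge 2$, $d\ge 3$, $ab^{-1}\equiv -1\pmod{2^{\beta}}$ and $2\,\|\,\mathrm{Ord}_p(ab^{-1})$ for every prime $p$ dividing $d$. 2. If $ab$ is even, then $\ell=2^{\beta}d\in G_{(a,b)}$ if and only if one of the following statements holds: (a) $\beta=0$ and $d=1$; (b) $\beta=0$, $d\ge 3$, and there exists an integer $s\ge 1$ such that $2^s\,\|\,\mathrm{Ord}_p(ab^{-1})$ for every prime $p$ dividing $d$.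
   Context: For coprime nonzero integers $a,b$, a positive integer $\ell$ is called good (with respect to $a$ and $b$) if there exists a positive integer $k$ such that $\ell\mid a^k+b^k$; $G_{(a,b)}$ denotes the set of all good integers with respect to $a$ and $b$. Here $b^{-1}$ denotes the multiplicative inverse of $b$ modulo $\ell$, and for a divisor $m$ of $\ell$, $\mathrm{Ord}_m(ab^{-1})$ denotes the multiplicative order of $ab^{-1}$ modulo $m$. The notation $2^{\gamma}\,\|\,n$ means that $\gamma$ is the largest integer such that $2^{\gamma}\mid n$. *)

theory Defs
  imports "HOL-Number_Theory.Number_Theory"
begin

definition good_integers :: "int \<Rightarrow> int \<Rightarrow> nat set" where
  "good_integers a b = {l. l > 0 \<and> (\<exists>k::nat. k > 0 \<and> int l dvd a ^ k + b ^ k)}"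

(* b^(-1) is an inverse of b modulo l, not modulo the divisor m of l
   at which the order or the congruence is taken. *)
definition ab_inv :: "nat \<Rightarrow> int \<Rightarrow> int \<Rightarrow> int" where
  "ab_inv l a b = a * modular_inverse (int l) b"

end

theory Submission
  imports Defs
begin

text \<open>
  Put \<open>x = a b\<^sup>-\<^sup>1\<close> modulo \<open>l\<close>. Since \<open>b\<close> is a unit modulo \<open>l\<close>, the integer \<open>l\<close> is good precisely
  when \<open>x ^ k = -1\<close> modulo \<open>l\<close> for some \<open>k > 0\<close>, that is, when one and the same \<open>k\<close> works modulo
  \<open>2 ^ \<beta>\<close> and modulo \<open>d\<close>. The only information about \<open>k\<close> which the two moduli share is its 2-adic
  valuation.

  Modulo an odd prime \<open>p\<close>, if \<open>x ^ k = -1\<close>, then the order of \<open>x\<close> divides \<open>2 * k\<close> but not \<open>k\<close>, so its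
  2-adic valuation is exactly one more than that of \<open>k\<close>
  (\<open>multiplicity_ord_of_power_eq_minus_one\<close>). Hence all primes dividing \<open>d\<close> see the same valuation.
  Conversely, if the order \<open>n\<close> is even, then \<open>x ^ (n div 2)\<close> is a square root of \<open>1\<close> other than \<open>1\<close>
  in a field, so it is \<open>-1\<close>, and any odd multiple of \<open>n div 2\<close> is as good as \<open>n div 2\<close>. If the
  orders modulo the various primes have the same 2-adic valuation, an exponent which is
  simultaneously such an odd multiple for all of them exists. The passage from the prime divisors
  of \<open>d\<close> to \<open>d\<close> itself costs one further odd factor, namely \<open>d\<close>
  (\<open>dvd_power_plus_one\<close>). Together this yields \<open>power_eq_minus_one_odd_modulus_iff\<close>, which
  prescribes the 2-adic valuation of \<open>k\<close>.

  For the power of two, \<open>\<beta> \<le> 1\<close> imposes no restriction on \<open>k\<close>. For \<open>\<beta> \<ge> 2\<close>, an even power of \<open>x\<close> is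
  never \<open>-1\<close> modulo 4, so \<open>k\<close> must be odd, and then \<open>x ^ k + 1\<close> is \<open>x + 1\<close> times a sum of an odd number
  of odd terms, which forces \<open>x = -1\<close> modulo \<open>2 ^ \<beta>\<close>. So \<open>k\<close> has valuation 0 and the orders modulo
  the primes dividing \<open>d\<close> have valuation 1.
\<close>

section \<open>Multiplicative orders of integers\<close>

lemma ord_int_eq_ord_nat:
  assumes "n > 0"
  shows "ord (int n) x = ord n (nat (x mod int n))"
proof -
  define y where "y = nat (x mod int n)"
  have xy: "[x = int y] (mod int n)"
    using assms by (simp add: y_def cong_def)
  have "coprime (int n) x \<longleftrightarrow> coprime (int n) (int y)"
    using xy by (metis cong_imp_coprime cong_sym coprime_commute)
  hence "coprime (int n) x \<longleftrightarrow> coprime n y"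
    by simp
  moreover have "[x ^ k = 1] (mod int n) \<longleftrightarrow> [y ^ k = 1] (mod n)" for k
  proof -
    have "[x ^ k = 1] (mod int n) \<longleftrightarrow> [int y ^ k = 1] (mod int n)"
      using cong_pow[OF xy] by (metis cong_sym cong_trans)
    also have "\<dots> \<longleftrightarrow> [int (y ^ k) = int 1] (mod int n)"
      by simp
    finally show ?thesis
      by (simp only: cong_int_iff)
  qed
  ultimately show ?thesis
    unfolding ord_def y_def[symmetric] by simp
qed

lemma ord_int_divides:
  assumes "n > 0"
  shows "[x ^ k = 1] (mod int n) \<longleftrightarrow> ord (int n) x dvd k"
proof -
  define y where "y = nat (x mod int n)"
  have xy: "[x = int y] (mod int n)"
    using assms by (simp add: y_def cong_def)
  have "[x ^ k = 1] (mod int n) \<longleftrightarrow> [int (y ^ k) = int 1] (mod int n)"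
    using cong_pow[OF xy, of k] by (auto intro: cong_trans cong_sym)
  also have "\<dots> \<longleftrightarrow> ord n y dvd k"
    by (simp only: cong_int_iff ord_divides)
  finally show ?thesis
    using assms by (simp add: ord_int_eq_ord_nat y_def)
qed

section \<open>Powers congruent to minus one modulo an odd number\<close>

lemma cong_minus_one_iff_dvd: "[x = -1] (mod m) \<longleftrightarrow> m dvd x + 1" for x m :: int
  by (simp add: cong_iff_dvd_diff)

lemma cong_minus_one_odd_power:
  fixes x m :: int
  assumes "[x = -1] (mod m)" "odd k"
  shows "[x ^ k = -1] (mod m)"
  using cong_pow[OF assms(1), of k] assms(2) by simp

lemma multiplicity_ord_of_power_eq_minus_one:
  assumes "p > 2" and k: "k > 0" and pow: "[x ^ k = -1] (mod int p)"
  shows "multiplicity 2 (ord (int p) x) = Suc (multiplicity 2 k)"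
proof -
  define n where "n = ord (int p) x"
  have "[x ^ k * x ^ k = (-1) * (-1)] (mod int p)"
    by (rule cong_mult[OF pow pow])
  hence "[x ^ (2 * k) = 1] (mod int p)"
    by (simp add: mult_2 power_add)
  hence dvd: "n dvd 2 * k"
    using assms by (simp add: ord_int_divides n_def)
  have "\<not> [x ^ k = 1] (mod int p)"
  proof
    assume "[x ^ k = 1] (mod int p)"
    hence "[1 = - 1] (mod int p)"
      using pow by (metis cong_sym cong_trans)
    hence "int p dvd 2"
      by (simp add: cong_iff_dvd_diff)
    thus False
      using \<open>p > 2\<close> zdvd_imp_le by fastforce
  qed
  hence ndvd: "\<not> n dvd k"
    using assms by (simp add: ord_int_divides n_def)
  obtain c where c: "2 * k = n * c"
    using dvd by blast
  \<comment> \<open>An even cofactor could be halved, which would make the order divide the exponent itself.\<close>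
  have "odd c"
  proof
    assume "even c"
    then obtain c' where "c = 2 * c'" by blast
    with c have "k = n * c'" by simp
    with ndvd show False by simp
  qed
  have "n * c \<noteq> 0"
    using k by (simp flip: c)
  hence "n \<noteq> 0" "c \<noteq> 0"
    by simp_all
  have "Suc (multiplicity 2 k) = multiplicity 2 (2 * k)"
    using k by (simp add: multiplicity_times_same)
  also have "\<dots> = multiplicity 2 n + multiplicity 2 c"
    unfolding c using \<open>n \<noteq> 0\<close> \<open>c \<noteq> 0\<close> by (simp add: prime_elem_multiplicity_mult_distrib)
  also have "multiplicity 2 c = 0"
    using \<open>odd c\<close> by (simp add: not_dvd_imp_multiplicity_0)
  finally show ?thesis
    by (simp add: n_def)
qed

lemma power_half_ord_eq_minus_one:
  assumes "prime p" and "ord (int p) x = 2 * m" and "m > 0"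
  shows "[x ^ m = -1] (mod int p)"
proof -
  have p: "p > 0" "prime (int p)"
    using assms by (auto simp: prime_gt_0_nat)
  have "[x ^ (2 * m) = 1] (mod int p)"
    using assms p by (simp add: ord_int_divides)
  hence "int p dvd x ^ (2 * m) - 1"
    by (simp add: cong_iff_dvd_diff)
  also have "x ^ (2 * m) - 1 = (x ^ m - 1) * (x ^ m + 1)"
    by (simp only: mult_2 power_add) (simp add: algebra_simps)
  finally have "int p dvd (x ^ m - 1) * (x ^ m + 1)" .
  hence "int p dvd x ^ m - 1 \<or> int p dvd x ^ m + 1"
    using p prime_dvd_mult_iff by blast
  moreover have "\<not> int p dvd x ^ m - 1"
    using assms p ord_int_divides[of p x m]
    by (auto simp: cong_iff_dvd_diff dest: dvd_imp_le)
  ultimately show ?thesis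
    by (simp add: cong_minus_one_iff_dvd)
qed

text \<open>
  In \<open>w ^ p - 1 = (w - 1) * (\<Sum>i<p. w ^ i)\<close>, each of the \<open>p\<close> summands is \<open>1\<close> modulo \<open>p\<close>, so the
  second factor contributes the additional \<open>p\<close>.
\<close>
lemma mult_dvd_power_minus_one:
  fixes e w :: int
  assumes "e dvd w - 1" "int p dvd w - 1"
  shows "int p * e dvd w ^ p - 1"
proof -
  have "[w = 1] (mod int p)"
    using assms by (simp add: cong_iff_dvd_diff)
  hence "[(\<Sum>i<p. w ^ i) = (\<Sum>i<p. 1 ^ i)] (mod int p)"
    by (intro cong_sum cong_pow)
  hence "int p dvd (\<Sum>i<p. w ^ i)"
    by (simp add: cong_dvd_iff)
  hence "int p * e dvd (\<Sum>i<p. w ^ i) * (w - 1)"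
    using assms by (intro mult_dvd_mono)
  thus ?thesis
    by (simp add: power_diff_1_eq mult.commute)
qed

text \<open>
  Being \<open>1\<close> modulo every prime divisor of \<open>d\<close> lifts to \<open>d\<close> by raising to the power \<open>d\<close>: each prime
  factor of the exponent adds that prime to the modulus.
\<close>
lemma dvd_power_minus_one:
  fixes w :: int
  assumes "d > 0" "\<And>p. prime p \<Longrightarrow> p dvd d \<Longrightarrow> int p dvd w - 1"
  shows "int d dvd w ^ d - 1"
  using assms
proof (induction d rule: prime_divisors_induct)
  case (factor p e)
  have "int e dvd w ^ e - 1"
    using factor by auto
  moreover have "int p dvd w ^ e - 1"
  proof -
    have "int p dvd w - 1"
      using factor by auto
    also have "w - 1 dvd w ^ e - 1"
      by (simp add: power_diff_1_eq)
    finally show ?thesis .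
  qed
  ultimately have "int p * int e dvd (w ^ e) ^ p - 1"
    by (rule mult_dvd_power_minus_one)
  thus ?case
    by (simp add: power_mult mult.commute)
qed auto

lemma dvd_power_plus_one:
  fixes y :: int
  assumes "odd d" "\<And>p. prime p \<Longrightarrow> p dvd d \<Longrightarrow> int p dvd y + 1"
  shows "int d dvd y ^ d + 1"
proof -
  have "int d dvd (- y) ^ d - 1"
  proof (rule dvd_power_minus_one)
    show "d > 0"
      using assms(1) by (rule odd_pos)
    show "int p dvd - y - 1" if "prime p" "p dvd d" for p
    proof -
      have "int p dvd - (y + 1)"
        unfolding dvd_minus_iff using that by (rule assms(2))
      thus ?thesis by simp
    qed
  qed
  also have "(- y) ^ d - 1 = - (y ^ d + 1)"
    using assms(1) by simp
  finally show ?thesis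
    unfolding dvd_minus_iff .
qed

text \<open>
  The 2-adic valuation \<open>t\<close> of the exponent is prescribed because the power of two in the modulus
  of the final theorem may restrict it.
\<close>
lemma power_eq_minus_one_odd_modulus_iff:
  fixes x :: int
  assumes "odd d"
  shows "(\<exists>k>0. multiplicity 2 k = t \<and> [x ^ k = -1] (mod int d)) \<longleftrightarrow>
         (\<forall>p. prime p \<and> p dvd d \<longrightarrow> multiplicity 2 (ord (int p) x) = Suc t)"
    (is "?lhs \<longleftrightarrow> ?rhs")
proof
  assume ?lhs
  then obtain k where k: "k > 0" "multiplicity 2 k = t" "[x ^ k = -1] (mod int d)"
    by blast
  show ?rhs
  proof (intro allI impI, elim conjE)
    fix p :: nat assume p: "prime p" "p dvd d"
    have "p \<noteq> 2"
      using p assms by auto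
    with p have "p > 2"
      using prime_ge_2_nat[of p] by linarith
    moreover have "[x ^ k = -1] (mod int p)"
      using k(3) p(2) by (meson cong_dvd_modulus int_dvd_int_iff)
    ultimately show "multiplicity 2 (ord (int p) x) = Suc t"
      using k multiplicity_ord_of_power_eq_minus_one by blast
  qed
next
  assume R: ?rhs
  define P where "P = prime_factors d"
  have P: "p \<in> P \<longleftrightarrow> prime p \<and> p dvd d" for p
    using assms by (auto simp: P_def in_prime_factors_iff intro: Nat.gr0I)
  define r where "r p = ord (int p) x div 2 ^ Suc t" for p :: nat
  have r: "ord (int p) x = 2 * (2 ^ t * r p)" "odd (r p)" if "p \<in> P" for p
  proof -
    have m: "multiplicity 2 (ord (int p) x) = Suc t"
      using R that P by blast
    \<comment> \<open>The valuation is positive and \<open>multiplicity 2 0 = 0\<close>, so the order is not 0.\<close>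
    show "odd (r p)"
      using multiplicity_decompose[of "ord (int p) x" 2] m unfolding r_def
      by (cases "ord (int p) x = 0") auto
    have "2 ^ Suc t dvd ord (int p) x"
      using multiplicity_dvd[of 2 "ord (int p) x"] unfolding m .
    thus "ord (int p) x = 2 * (2 ^ t * r p)"
      unfolding r_def by (metis dvd_mult_div_cancel mult.assoc power_Suc)
  qed
  define q where "q = (\<Prod>p\<in>P. r p)"
  have "odd q"
    unfolding q_def using r(2) by (simp add: P_def even_prod_iff)
  have half: "[x ^ (2 ^ t * q) = -1] (mod int p)" if "p \<in> P" for p
  proof -
    have "r p dvd q"
      unfolding q_def using that by (intro dvd_prodI) (auto simp: P_def)
    then obtain c where c: "q = r p * c" by blast
    hence "odd c"
      using \<open>odd q\<close> by simp
    have "[x ^ (2 ^ t * r p) = -1] (mod int p)"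
      using that r[OF that] P
      by (intro power_half_ord_eq_minus_one) (auto intro: Nat.gr0I)
    hence "[(x ^ (2 ^ t * r p)) ^ c = -1] (mod int p)"
      using \<open>odd c\<close> by (rule cong_minus_one_odd_power)
    thus ?thesis
      by (simp add: c mult.assoc flip: power_mult)
  qed
  define k where "k = 2 ^ t * (q * d)"
  have "int d dvd (x ^ (2 ^ t * q)) ^ d + 1"
    using assms half P by (intro dvd_power_plus_one) (auto simp: cong_minus_one_iff_dvd)
  hence "[x ^ k = -1] (mod int d)"
    by (simp add: k_def cong_minus_one_iff_dvd mult.assoc flip: power_mult)
  moreover have "odd (q * d)"
    using \<open>odd q\<close> assms by simp
  hence "k > 0" "multiplicity 2 k = t"
    by (auto simp: k_def intro: Nat.gr0I multiplicity_decomposeI)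
  ultimately show ?lhs
    by blast
qed

section \<open>Powers congruent to minus one modulo a power of two\<close>

text \<open>
  Even powers of odd integers are \<open>1\<close> modulo 4, which excludes even exponents. For odd \<open>k\<close>, the cofactor
  of \<open>x + 1\<close> in \<open>x ^ k + 1\<close> is odd, so all powers of two in \<open>x ^ k + 1\<close> come from \<open>x + 1\<close>.
\<close>
lemma power_eq_minus_one_two_power_iff:
  fixes x :: int
  assumes "\<beta> \<ge> 2" "k > 0"
  shows "[x ^ k = -1] (mod 2 ^ \<beta>) \<longleftrightarrow> odd k \<and> [x = -1] (mod 2 ^ \<beta>)"
proof
  assume pow: "[x ^ k = -1] (mod 2 ^ \<beta>)"
  have "(2::int) ^ 2 dvd 2 ^ \<beta>"
    using assms by (intro le_imp_power_dvd)
  hence mod4: "[x ^ k = -1] (mod 4)"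
    using pow by (auto intro: cong_dvd_modulus)
  have "odd x"
  proof
    assume "even x"
    hence "even (x ^ k)"
      using assms by simp
    moreover have "4 dvd x ^ k + 1"
      using mod4 by (simp only: cong_minus_one_iff_dvd)
    hence "even (x ^ k + 1)"
      by (rule dvd_trans[rotated]) simp
    ultimately show False
      by simp
  qed
  have "odd k"
  proof
    assume "even k"
    then obtain j where "k = 2 * j" by blast
    hence sq: "x ^ k = (x ^ j)\<^sup>2"
      by (simp add: mult.commute flip: power_mult)
    have "odd (x ^ j)"
      using \<open>odd x\<close> by simp
    then obtain c where "x ^ j = 2 * c + 1"
      by (rule oddE)
    hence "x ^ k = 4 * (c\<^sup>2 + c) + 1"
      unfolding sq by (simp add: power2_eq_square algebra_simps)
    moreover have "4 dvd x ^ k + 1"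
      using mod4 by (simp add: cong_minus_one_iff_dvd)
    ultimately show False
      by presburger
  qed
  define S where "S = (\<Sum>i<k. (- x) ^ i)"
  have "(- x) ^ k - 1 = (- x - 1) * S"
    unfolding S_def by (rule power_diff_1_eq)
  hence "x ^ k + 1 = (x + 1) * S"
    using \<open>odd k\<close> by (simp add: algebra_simps)
  hence "2 ^ \<beta> dvd (x + 1) * S"
    using pow by (simp add: cong_minus_one_iff_dvd)
  moreover have "odd S"
    unfolding S_def using \<open>odd x\<close> \<open>odd k\<close> by (simp add: even_sum_iff)
  hence "coprime (2 ^ \<beta>) S"
    by simp
  ultimately have "2 ^ \<beta> dvd x + 1"
    using coprime_dvd_mult_left_iff by blast
  thus "odd k \<and> [x = -1] (mod 2 ^ \<beta>)"
    using \<open>odd k\<close> by (simp add: cong_minus_one_iff_dvd)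
next
  assume "odd k \<and> [x = -1] (mod 2 ^ \<beta>)"
  thus "[x ^ k = -1] (mod 2 ^ \<beta>)"
    by (simp add: cong_minus_one_odd_power)
qed

lemma power_eq_minus_one_two_iff:
  fixes x :: int
  assumes "\<beta> \<le> 1" "coprime x (2 ^ \<beta>)"
  shows "[x ^ k = -1] (mod 2 ^ \<beta>)"
proof (cases "\<beta> = 0")
  case False
  with assms have "\<beta> = 1" "odd x"
    by auto
  thus ?thesis
    by (simp add: cong_minus_one_iff_dvd)
qed simp

section \<open>Good integers\<close>

lemma coprime_ab_inv:
  assumes "coprime a (int l)" "coprime b (int l)"
  shows "coprime (ab_inv l a b) (int l)"
  using assms by (simp add: ab_inv_def coprime_modular_inverse)

lemma good_integers_iff_ab_inv_power:
  assumes "l > 0" "coprime b (int l)"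
  shows "l \<in> good_integers a b \<longleftrightarrow> (\<exists>k>0. [ab_inv l a b ^ k = -1] (mod int l))"
proof -
  define x where "x = ab_inv l a b"
  have "[b * modular_inverse (int l) b = 1] (mod int l)"
    using assms by (intro cong_modular_inverse1)
  hence "[a * (b * modular_inverse (int l) b) = a * 1] (mod int l)"
    by (intro cong_mult cong_refl)
  hence bx: "[b * x = a] (mod int l)"
    by (simp add: x_def ab_inv_def algebra_simps)
  have "int l dvd a ^ k + b ^ k \<longleftrightarrow> [x ^ k = -1] (mod int l)" for k
  proof -
    have "[(b * x) ^ k + b ^ k = a ^ k + b ^ k] (mod int l)"
      by (intro cong_add cong_pow bx cong_refl)
    hence "[b ^ k * (x ^ k + 1) = a ^ k + b ^ k] (mod int l)"
      by (simp add: power_mult_distrib algebra_simps)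
    hence "int l dvd a ^ k + b ^ k \<longleftrightarrow> int l dvd b ^ k * (x ^ k + 1)"
      by (simp add: cong_dvd_iff)
    also have "\<dots> \<longleftrightarrow> int l dvd x ^ k + 1"
      using assms by (intro coprime_dvd_mult_right_iff) (simp add: coprime_commute)
    finally show ?thesis
      by (simp add: cong_minus_one_iff_dvd)
  qed
  thus ?thesis
    using assms by (simp add: good_integers_def x_def)
qed

text \<open>
  The two cases of the characterisation, before the trivial odd part \<open>d = 1\<close> is separated from
  \<open>d \<ge> 3\<close>; the conditions on primes dividing \<open>d\<close> hold vacuously for \<open>d = 1\<close>.
\<close>
lemma good_integers_iff:
  fixes a b :: int
  assumes l: "l = 2 ^ \<beta> * d" and "odd d"
    and a: "coprime a (int l)" and b: "coprime b (int l)"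
  defines "x \<equiv> ab_inv l a b"
  shows "\<beta> \<le> 1 \<Longrightarrow> l \<in> good_integers a b \<longleftrightarrow>
           (\<exists>s\<ge>1. \<forall>p. prime p \<and> p dvd d \<longrightarrow> multiplicity 2 (ord (int p) x) = s)"
    and "\<beta> \<ge> 2 \<Longrightarrow> l \<in> good_integers a b \<longleftrightarrow> [x = -1] (mod 2 ^ \<beta>) \<and>
           (\<forall>p. prime p \<and> p dvd d \<longrightarrow> multiplicity 2 (ord (int p) x) = 1)"
proof -
  have "l > 0"
    using l \<open>odd d\<close> by (auto intro: Nat.gr0I)
  have cop: "coprime (2 ^ \<beta>) (int d)"
    using \<open>odd d\<close> by simp
  have "[x ^ k = -1] (mod int l) \<longleftrightarrow> [x ^ k = -1] (mod 2 ^ \<beta>) \<and> [x ^ k = -1] (mod int d)" for k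
    unfolding l using cop
    by (auto simp: cong_minus_one_iff_dvd divides_mult intro: dvd_mult_left dvd_mult_right)
  hence good: "l \<in> good_integers a b \<longleftrightarrow>
      (\<exists>k>0. [x ^ k = -1] (mod 2 ^ \<beta>) \<and> [x ^ k = -1] (mod int d))"
    using good_integers_iff_ab_inv_power[OF \<open>l > 0\<close> b] by (simp add: x_def)
  {
    assume "\<beta> \<le> 1"
    moreover have "coprime x (2 ^ \<beta>)"
      using coprime_ab_inv[OF a b] by (simp add: x_def l)
    ultimately have "l \<in> good_integers a b \<longleftrightarrow> (\<exists>k>0. [x ^ k = -1] (mod int d))"
      using power_eq_minus_one_two_iff good by blast
    also have "\<dots> \<longleftrightarrow> (\<exists>t. \<exists>k>0. multiplicity 2 k = t \<and> [x ^ k = -1] (mod int d))"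
      by blast
    also have "\<dots> \<longleftrightarrow>
        (\<exists>t. \<forall>p. prime p \<and> p dvd d \<longrightarrow> multiplicity 2 (ord (int p) x) = Suc t)"
      unfolding power_eq_minus_one_odd_modulus_iff[OF \<open>odd d\<close>] ..
    also have "\<dots> \<longleftrightarrow> (\<exists>s\<ge>1. \<forall>p. prime p \<and> p dvd d \<longrightarrow> multiplicity 2 (ord (int p) x) = s)"
      by (metis One_nat_def Suc_le_D Suc_le_mono le0)
    finally show "l \<in> good_integers a b \<longleftrightarrow>
        (\<exists>s\<ge>1. \<forall>p. prime p \<and> p dvd d \<longrightarrow> multiplicity 2 (ord (int p) x) = s)" .
  next
    assume "\<beta> \<ge> 2"
    hence "l \<in> good_integers a b \<longleftrightarrow>
        [x = -1] (mod 2 ^ \<beta>) \<and> (\<exists>k>0. odd k \<and> [x ^ k = -1] (mod int d))"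
      using good power_eq_minus_one_two_power_iff by blast
    also have "(\<exists>k>0. odd k \<and> [x ^ k = -1] (mod int d)) \<longleftrightarrow>
        (\<exists>k>0. multiplicity 2 k = 0 \<and> [x ^ k = -1] (mod int d))"
      by (auto simp: multiplicity_eq_zero_iff)
    also have "\<dots> \<longleftrightarrow> (\<forall>p. prime p \<and> p dvd d \<longrightarrow> multiplicity 2 (ord (int p) x) = 1)"
      unfolding power_eq_minus_one_odd_modulus_iff[OF \<open>odd d\<close>] by simp
    finally show "l \<in> good_integers a b \<longleftrightarrow> [x = -1] (mod 2 ^ \<beta>) \<and>
        (\<forall>p. prime p \<and> p dvd d \<longrightarrow> multiplicity 2 (ord (int p) x) = 1)" .
  }
qed

theorem theorem1:
  fixes a b :: int and l d \<beta> :: nat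
  assumes "a \<noteq> 0" and "b \<noteq> 0"
    and "l = 2 ^ \<beta> * d" and "d > 0" and "odd d"
    and "coprime a b" and "coprime a (int l)" and "coprime b (int l)"
  shows "(odd (a * b) \<longrightarrow>
           (l \<in> good_integers a b \<longleftrightarrow>
              (\<beta> \<in> {0, 1} \<and> d = 1)
            \<or> (\<beta> \<in> {0, 1} \<and> d \<ge> 3 \<and>
                 (\<exists>s::nat. s \<ge> 1 \<and> (\<forall>p::nat. prime p \<and> p dvd d \<longrightarrow>
                    multiplicity 2 (ord (int p) (ab_inv l a b)) = s)))
            \<or> (\<beta> \<ge> 2 \<and> d = 1 \<and> [ab_inv l a b = -1] (mod 2 ^ \<beta>))
            \<or> (\<beta> \<ge> 2 \<and> d \<ge> 3 \<and> [ab_inv l a b = -1] (mod 2 ^ \<beta>) \<and>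
                 (\<forall>p::nat. prime p \<and> p dvd d \<longrightarrow>
                    multiplicity 2 (ord (int p) (ab_inv l a b)) = 1))))
       \<and> (even (a * b) \<longrightarrow>
           (l \<in> good_integers a b \<longleftrightarrow>
              (\<beta> = 0 \<and> d = 1)
            \<or> (\<beta> = 0 \<and> d \<ge> 3 \<and>
                 (\<exists>s::nat. s \<ge> 1 \<and> (\<forall>p::nat. prime p \<and> p dvd d \<longrightarrow>
                    multiplicity 2 (ord (int p) (ab_inv l a b)) = s)))))"
proof -
  define G where "G s \<longleftrightarrow>
    (\<forall>p. prime p \<and> p dvd d \<longrightarrow> multiplicity 2 (ord (int p) (ab_inv l a b)) = s)" for s
  have small: "l \<in> good_integers a b \<longleftrightarrow> (\<exists>s\<ge>1. G s)" if "\<beta> \<le> 1"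
    unfolding G_def using that assms by (intro good_integers_iff(1))
  have large: "l \<in> good_integers a b \<longleftrightarrow> [ab_inv l a b = -1] (mod 2 ^ \<beta>) \<and> G 1" if "\<beta> \<ge> 2"
    unfolding G_def using that assms by (intro good_integers_iff(2))
  have d: "d = 1 \<or> d \<ge> 3"
    using \<open>odd d\<close> by presburger
  have one: "G s" if "d = 1" for s
    using that by (auto simp: G_def)
  have even: "\<beta> = 0" if "even (a * b)"
  proof (rule ccontr)
    assume "\<beta> \<noteq> 0"
    hence "even (int l)"
      using assms(3) by simp
    moreover have "coprime (a * b) (int l)"
      using assms(7,8) by (simp only: coprime_mult_left_iff)
    ultimately show False
      using that by (metis coprime_common_divisor odd_one)
  qed
  show ?thesis
    unfolding G_def[symmetric]
  proof (intro conjI impI)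
    show "l \<in> good_integers a b \<longleftrightarrow> (\<beta> \<in> {0, 1} \<and> d = 1) \<or>
        (\<beta> \<in> {0, 1} \<and> d \<ge> 3 \<and> (\<exists>s\<ge>1. G s)) \<or>
        (\<beta> \<ge> 2 \<and> d = 1 \<and> [ab_inv l a b = -1] (mod 2 ^ \<beta>)) \<or>
        (\<beta> \<ge> 2 \<and> d \<ge> 3 \<and> [ab_inv l a b = -1] (mod 2 ^ \<beta>) \<and> G 1)"
    proof (cases "\<beta> \<le> 1")
      case True
      hence "\<beta> \<in> {0, 1}" "\<not> \<beta> \<ge> 2"
        by auto
      thus ?thesis
        using small[OF True] d one by blast
    next
      case False
      hence "\<beta> \<notin> {0, 1}" "\<beta> \<ge> 2"
        by auto
      thus ?thesis
        using large d one by blast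
    qed
  next
    assume "even (a * b)"
    hence "\<beta> = 0" by (rule even)
    thus "l \<in> good_integers a b \<longleftrightarrow>
        (\<beta> = 0 \<and> d = 1) \<or> (\<beta> = 0 \<and> d \<ge> 3 \<and> (\<exists>s\<ge>1. G s))"
      using small d one by auto
  qed
qed

end
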